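(* Let $G$ be a finite simple graph and $n\ge2$. The map $$j_G:\mathrm{Conf}_G(\mathbb P^{n-1})\longrightarrow\mathcal X^{n-1}(G),\qquad (\ell_v)\longmapsto\bigl((\ell_v),(\langle\ell_u,\ell_v\rangle)_{uv\in E(G)}\bigr),$$ is an open immersion with image the locus on which the endpoints of every edge are distinct. Its image lies in $\mathcal V^{n-1}(G)$ and is dense there. In particular, $\overline{j_G(\mathrm{Conf}_G(\mathbb P^{n-1}))}=\mathcal V^{n-1}(G)$.
   Context: Everything is over $\mathbb C$; points of $\mathbb P^{n-1}$ are one-dimensional subspaces of $\mathbb C^n$. $\mathrm{Conf}_G(\mathbb P^{n-1})=\{(\ell_v)\in(\mathbb P^{n-1})^{V(G)}:\ell_u\ne\ell_v\text{ whenever }uv\in E(G)\}$. With $d=n-1$, the picture space of $G$ is the projective incidence variety $\mathcal X^d(G)=\{((\ell_v),(P_e))\in(\mathbb P^d)^{V(G)}\times\mathrm{Gr}(2,n)^{E(G)}:\ell_u,\ell_v\subseteq P_{uv}\text{ for every }uv\in E(G)\}$. The picture variety $\mathcal V^d(G)$ is the closure in $\mathcal X^d(G)$ of the locus on which all vertex points $\ell_v$ are pairwise distinct. *)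

theory Defs
  imports "HOL-Analysis.Analysis"
begin

text \<open>
  Varieties are classical ones over the complex numbers: sets of closed points inside an ambient
  space with several blocks of homogeneous coordinates (a product of projective spaces), with the
  Zariski topology and regular functions. Since the field is infinite, polynomials are identified
  with polynomial functions.
\<close>

section \<open>Subsets of multiprojective spaces as varieties\<close>

text \<open>
  \<open>multiform X b d F\<close>: \<open>F\<close> is a polynomial function in the variables \<open>X\<close>, multihomogeneous of
  multidegree \<open>d\<close>, where \<open>b x\<close> is the block to which the variable \<open>x\<close> belongs.
\<close>

inductive multiform ::
  "'x set \<Rightarrow> ('x \<Rightarrow> 'i) \<Rightarrow> ('i \<Rightarrow> nat) \<Rightarrow> (('x \<Rightarrow> complex) \<Rightarrow> complex) \<Rightarrow> bool"
  for X :: "'x set" and b :: "'x \<Rightarrow> 'i" where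
  const: "multiform X b (\<lambda>_. 0) (\<lambda>_. c)"
| var: "x \<in> X \<Longrightarrow> multiform X b (\<lambda>i. if i = b x then 1 else 0) (\<lambda>z. z x)"
| add: "multiform X b d F \<Longrightarrow> multiform X b d G \<Longrightarrow> multiform X b d (\<lambda>z. F z + G z)"
| mult: "multiform X b d F \<Longrightarrow> multiform X b d' G \<Longrightarrow>
    multiform X b (\<lambda>i. d i + d' i) (\<lambda>z. F z * G z)"

text \<open>
  \<open>hcoords A p\<close> is the set of all vectors of homogeneous coordinates of the point \<open>p\<close>. In the
  instances below two of them differ on \<open>hvars A\<close> by a nonzero scalar in every block, so that
  vanishing of a form and the value of a quotient of two forms of equal multidegree do not depend
  on the choice.
\<close>

record ('p, 'x, 'i) ambient =
  points :: "'p set"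
  hvars :: "'x set"
  block :: "'x \<Rightarrow> 'i"
  hcoords :: "'p \<Rightarrow> ('x \<Rightarrow> complex) set"

definition forms :: "('p, 'x, 'i) ambient \<Rightarrow> (('x \<Rightarrow> complex) \<Rightarrow> complex) set" where
  "forms A = {F. \<exists>d. multiform (hvars A) (block A) d F}"

definition principal_open ::
  "('p, 'x, 'i) ambient \<Rightarrow> (('x \<Rightarrow> complex) \<Rightarrow> complex) \<Rightarrow> 'p set" where
  "principal_open A F = {p \<in> points A. \<forall>z\<in>hcoords A p. F z \<noteq> 0}"

definition zariski_open :: "('p, 'x, 'i) ambient \<Rightarrow> 'p set \<Rightarrow> bool" where
  "zariski_open A U \<longleftrightarrow> (\<exists>S \<subseteq> forms A. U = (\<Union>F\<in>S. principal_open A F))"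

lemma principal_open_Int:
  assumes "F \<in> forms A" "G \<in> forms A"
  shows "\<exists>H\<in>forms A. principal_open A H = principal_open A F \<inter> principal_open A G"
proof
  obtain d d' where "multiform (hvars A) (block A) d F" "multiform (hvars A) (block A) d' G"
    using assms unfolding forms_def by blast
  from multiform.mult[OF this] show "(\<lambda>z. F z * G z) \<in> forms A"
    unfolding forms_def mem_Collect_eq by (rule exI[where x = "\<lambda>i. d i + d' i"])
  show "principal_open A (\<lambda>z. F z * G z) = principal_open A F \<inter> principal_open A G"
    by (rule set_eqI)
      (simp only: principal_open_def mem_Collect_eq Int_iff mult_eq_0_iff de_Morgan_disj ball_conj_distrib, argo)
qed

lemma zariski_open_iff:
  "zariski_open A U \<longleftrightarrow> (\<forall>p\<in>U. \<exists>F\<in>forms A. p \<in> principal_open A F \<and> principal_open A F \<subseteq> U)"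
  (is "_ \<longleftrightarrow> ?R")
proof
  assume "zariski_open A U"
  then show ?R unfolding zariski_open_def by auto
next
  assume R: ?R
  define S where "S = {F \<in> forms A. principal_open A F \<subseteq> U}"
  have "U \<subseteq> (\<Union>F\<in>S. principal_open A F)"
  proof
    fix p assume "p \<in> U"
    with R obtain F where "F \<in> forms A" "p \<in> principal_open A F" "principal_open A F \<subseteq> U"
      by (meson bspec)
    then have "F \<in> S" unfolding S_def by simp
    then show "p \<in> (\<Union>F\<in>S. principal_open A F)"
      by (rule UN_I[where B = "principal_open A"]) fact
  qed
  moreover have "(\<Union>F\<in>S. principal_open A F) \<subseteq> U"
    by (rule UN_least) (simp add: S_def)
  ultimately have "U = (\<Union>F\<in>S. principal_open A F)" by (rule subset_antisym)
  moreover have "S \<subseteq> forms A" unfolding S_def by simp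
  ultimately show "zariski_open A U"
    unfolding zariski_open_def by (intro exI[where x = S] conjI)
qed

lemma istopology_zariski_open: "istopology (zariski_open A)"
  unfolding istopology_def
proof (intro conjI allI impI)
  fix U W
  assume U: "zariski_open A U" and W: "zariski_open A W"
  show "zariski_open A (U \<inter> W)"
    unfolding zariski_open_iff
  proof
    fix p assume p: "p \<in> U \<inter> W"
    obtain F where F: "F \<in> forms A" "p \<in> principal_open A F" "principal_open A F \<subseteq> U"
      using U p unfolding zariski_open_iff by auto
    obtain G where G: "G \<in> forms A" "p \<in> principal_open A G" "principal_open A G \<subseteq> W"
      using W p unfolding zariski_open_iff by auto
    obtain H where "H \<in> forms A" "principal_open A H = principal_open A F \<inter> principal_open A G"
      using principal_open_Int[OF F(1) G(1)] by auto
    then show "\<exists>H\<in>forms A. p \<in> principal_open A H \<and> principal_open A H \<subseteq> U \<inter> W"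
      using F G by auto
  qed
next
  fix K
  assume K: "\<forall>U\<in>K. zariski_open A U"
  show "zariski_open A (\<Union>K)"
    unfolding zariski_open_iff
  proof
    fix p assume "p \<in> \<Union>K"
    then obtain U where U: "U \<in> K" "p \<in> U" by (rule UnionE)
    from K U(1) have "zariski_open A U" by (rule bspec)
    then obtain F where "F \<in> forms A" "p \<in> principal_open A F" "principal_open A F \<subseteq> U"
      using U(2) unfolding zariski_open_iff by auto
    moreover have "U \<subseteq> \<Union>K" using U(1) by (rule Union_upper)
    ultimately show "\<exists>F\<in>forms A. p \<in> principal_open A F \<and> principal_open A F \<subseteq> \<Union>K"
      by (meson subset_trans)
  qed
qed

definition zariski :: "('p, 'x, 'i) ambient \<Rightarrow> 'p set \<Rightarrow> 'p topology" where
  "zariski A X = subtopology (topology (zariski_open A)) X"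

definition regular_on :: "('p, 'x, 'i) ambient \<Rightarrow> 'p set \<Rightarrow> 'p set \<Rightarrow> ('p \<Rightarrow> complex) \<Rightarrow> bool" where
  "regular_on A X U f \<longleftrightarrow>
    (\<forall>p\<in>U. \<exists>W d F G. openin (zariski A X) W \<and> p \<in> W \<and> W \<subseteq> U \<and>
       multiform (hvars A) (block A) d F \<and> multiform (hvars A) (block A) d G \<and>
       (\<forall>q\<in>W. \<forall>z\<in>hcoords A q. G z \<noteq> 0 \<and> f q = F z / G z))"

definition morphism ::
  "('p, 'x, 'i) ambient \<Rightarrow> 'p set \<Rightarrow> ('q, 'y, 'j) ambient \<Rightarrow> 'q set \<Rightarrow> ('p \<Rightarrow> 'q) \<Rightarrow> bool" where
  "morphism A X B Y \<phi> \<longleftrightarrow>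
    continuous_map (zariski A X) (zariski B Y) \<phi> \<and>
    (\<forall>U f. openin (zariski B Y) U \<and> regular_on B Y U f \<longrightarrow>
       regular_on A X {p \<in> X. \<phi> p \<in> U} (f \<circ> \<phi>))"

definition isomorphism ::
  "('p, 'x, 'i) ambient \<Rightarrow> 'p set \<Rightarrow> ('q, 'y, 'j) ambient \<Rightarrow> 'q set \<Rightarrow> ('p \<Rightarrow> 'q) \<Rightarrow> bool" where
  "isomorphism A X B Y \<phi> \<longleftrightarrow> morphism A X B Y \<phi> \<and>
    (\<exists>\<psi>. morphism B Y A X \<psi> \<and> (\<forall>p\<in>X. \<psi> (\<phi> p) = p) \<and> (\<forall>q\<in>Y. \<phi> (\<psi> q) = q))"

definition open_immersion ::
  "('p, 'x, 'i) ambient \<Rightarrow> 'p set \<Rightarrow> ('q, 'y, 'j) ambient \<Rightarrow> 'q set \<Rightarrow> ('p \<Rightarrow> 'q) \<Rightarrow> bool" where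
  "open_immersion A X B Y \<phi> \<longleftrightarrow> morphism A X B Y \<phi> \<and>
    openin (zariski B Y) (\<phi> ` X) \<and> isomorphism A X B (\<phi> ` X) \<phi>"


section \<open>Graphs, configurations and pictures\<close>

definition finite_simple_graph :: "'v set \<Rightarrow> 'v set set \<Rightarrow> bool" where
  "finite_simple_graph V E \<longleftrightarrow> finite V \<and> (\<forall>e\<in>E. e \<subseteq> V \<and> card e = 2)"

definition grassmannian :: "nat \<Rightarrow> (complex ^ 'n) set set" where
  "grassmannian k = {W. vec.subspace W \<and> vec.dim W = k}"

abbreviation proj_space :: "(complex ^ 'n) set set" where
  "proj_space \<equiv> grassmannian 1"

definition vertex_ambient ::
  "'v set \<Rightarrow> ('v \<Rightarrow> (complex ^ 'n) set, 'v \<times> 'n, 'v) ambient" where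
  "vertex_ambient V = \<lparr>
     points = V \<rightarrow>\<^sub>E proj_space,
     hvars = V \<times> UNIV,
     block = fst,
     hcoords = (\<lambda>l. {z. \<forall>v\<in>V. vec.span {\<chi> i. z (v, i)} = l v}) \<rparr>"

text \<open>
  A product of Grassmannians of planes is embedded in a product of projective spaces by Pluecker
  coordinates: a plane with basis \<open>a, b\<close> has coordinates \<open>a\<^sub>i b\<^sub>j - a\<^sub>j b\<^sub>i\<close> for all ordered pairs
  \<open>(i, j)\<close>.
\<close>

datatype ('v, 'n) picture_var = Point 'v 'n | Pluecker "'v set" 'n 'n

fun picture_block :: "('v, 'n) picture_var \<Rightarrow> 'v + 'v set" where
  "picture_block (Point v i) = Inl v"
| "picture_block (Pluecker e i j) = Inr e"

type_synonym ('v, 'n) picture =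
  "('v \<Rightarrow> (complex ^ 'n) set) \<times> ('v set \<Rightarrow> (complex ^ 'n) set)"

definition picture_ambient ::
  "'v set \<Rightarrow> 'v set set \<Rightarrow> (('v, 'n) picture, ('v, 'n::finite) picture_var, 'v + 'v set) ambient" where
  "picture_ambient V E = \<lparr>
     points = (V \<rightarrow>\<^sub>E proj_space) \<times> (E \<rightarrow>\<^sub>E grassmannian 2),
     hvars = {Point v i | v i. v \<in> V} \<union> {Pluecker e i j | e i j. e \<in> E},
     block = picture_block,
     hcoords = (\<lambda>(l, P). {z.
       (\<forall>v\<in>V. vec.span {\<chi> i. z (Point v i)} = l v) \<and>
       (\<forall>e\<in>E. \<exists>a b. vec.span {a, b} = P e \<and>
          (\<forall>i j. z (Pluecker e i j) = a $ i * b $ j - a $ j * b $ i))}) \<rparr>"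

definition conf_space :: "'v set \<Rightarrow> 'v set set \<Rightarrow> ('v \<Rightarrow> (complex ^ 'n) set) set" where
  "conf_space V E = {l \<in> V \<rightarrow>\<^sub>E proj_space. \<forall>u v. {u, v} \<in> E \<longrightarrow> l u \<noteq> l v}"

definition picture_space :: "'v set \<Rightarrow> 'v set set \<Rightarrow> ('v, 'n::finite) picture set" where
  "picture_space V E = {(l, P) \<in> (V \<rightarrow>\<^sub>E proj_space) \<times> (E \<rightarrow>\<^sub>E grassmannian 2).
     \<forall>u v. {u, v} \<in> E \<longrightarrow> l u \<subseteq> P {u, v} \<and> l v \<subseteq> P {u, v}}"

definition picture_variety :: "'v set \<Rightarrow> 'v set set \<Rightarrow> ('v, 'n::finite) picture set" where
  "picture_variety V E = zariski (picture_ambient V E) (picture_space V E)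
     closure_of {(l, P) \<in> picture_space V E. inj_on l V}"

definition conf_embedding ::
  "'v set set \<Rightarrow> ('v \<Rightarrow> (complex ^ 'n) set) \<Rightarrow> ('v, 'n::finite) picture" where
  "conf_embedding E l = (l, \<lambda>e\<in>E. vec.span (\<Union>v\<in>e. l v))"

end

theory Submission
  imports Defs
begin

text \<open>
  Two distinct lines span a plane, and a plane containing both is their span; so on the locus where
  the endpoints of every edge are distinct, the planes of a picture are determined by its points
  (\<open>image_conf_embedding\<close>). The embedding \<open>j\<close> and the projection to the points are therefore
  inverse bijections between the configuration space and this locus.

  Both maps are given in homogeneous coordinates by multihomogeneous forms: the embedding by the
  minors \<open>x\<^sub>u\<^sub>,\<^sub>i x\<^sub>v\<^sub>,\<^sub>j - x\<^sub>u\<^sub>,\<^sub>j x\<^sub>v\<^sub>,\<^sub>i\<close>, the projection by a choice of coordinates. Substituting such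
  forms into a form gives a form again, so such a map pulls back open sets to open sets and
  quotients of forms of equal multidegree to quotients of forms of equal multidegree; this is
  \<open>morphism_by_forms\<close>. It needs that the vanishing of a form at a point is independent of the
  coordinate vector, which holds because coordinates are unique up to a scalar in each block. The
  locus is open: two lines are distinct where some minor of their generators is nonzero, which
  makes the configuration space open in \<open>(\<P>\<^sup>n\<^sup>-\<^sup>1)\<^sup>V\<close>, and the locus is its preimage under the
  projection.

  For the density, a picture with pairwise distinct points lies in the image of \<open>j\<close>, and conversely
  every nonempty principal open set of \<open>(\<P>\<^sup>n\<^sup>-\<^sup>1)\<^sup>V\<close> contains a tuple of pairwise distinct points
  (\<open>injective_meets_principal_open\<close>): move the given coordinates along a suitable straight line;
  the form defining the open set and the minors of all pairs restrict to nonzero polynomials in one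
  variable, and only finitely many parameters have to be avoided. Pulling neighbourhoods back along
  the continuous map \<open>j\<close> shows that the image of \<open>j\<close> and the locus of pairwise distinct points have
  the same closure.
\<close>

section \<open>Lines, planes and their minors\<close>

definition pluecker :: "complex ^ 'n \<Rightarrow> complex ^ 'n \<Rightarrow> 'n \<Rightarrow> 'n \<Rightarrow> complex" where
  "pluecker a b i j = a $ i * b $ j - a $ j * b $ i"

lemma proportional_if_pluecker_zero:
  fixes a b :: "complex ^ 'n::finite"
  assumes "\<And>i j. pluecker a b i j = 0" and "a \<noteq> 0"
  obtains k where "b = k *s a"
proof -
  obtain i where i: "a $ i \<noteq> 0" using \<open>a \<noteq> 0\<close> by (auto simp: vec_eq_iff)
  have "b = (b $ i / a $ i) *s a"
  proof (intro vec_eq_iff[THEN iffD2] allI)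
    fix j
    show "b $ j = ((b $ i / a $ i) *s a) $ j"
      using assms(1)[of i j] i by (simp add: pluecker_def field_simps)
  qed
  then show ?thesis by (rule that)
qed

lemma pluecker_proportional: "pluecker a (k *s a) i j = 0"
  by (simp add: pluecker_def)

lemma dim_pair_eq_2_iff:
  fixes a b :: "complex ^ 'n::finite"
  shows "vec.dim {a, b} = 2 \<longleftrightarrow> (\<exists>i j. pluecker a b i j \<noteq> 0)"
proof
  assume dim: "vec.dim {a, b} = 2"
  show "\<exists>i j. pluecker a b i j \<noteq> 0"
  proof (rule ccontr)
    assume "\<not> ?thesis"
    then have zero: "\<And>i j. pluecker a b i j = 0" by blast
    have "\<exists>c. {a, b} \<subseteq> vec.span {c}"
    proof (cases "a = 0")
      case True
      then show ?thesis by (auto intro: exI[of _ b] vec.span_base vec.span_zero)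
    next
      case False
      then obtain k where "b = k *s a" by (rule proportional_if_pluecker_zero[OF zero])
      then show ?thesis by (auto intro!: exI[of _ a] vec.span_base vec.span_scale)
    qed
    then obtain c where "{a, b} \<subseteq> vec.span {c}" by blast
    then have "vec.dim {a, b} \<le> card {c}" by (rule vec.dim_le_card) simp
    with dim show False by simp
  qed
next
  assume "\<exists>i j. pluecker a b i j \<noteq> 0"
  then obtain i j where ij: "pluecker a b i j \<noteq> 0" by blast
  then have "a \<noteq> 0" by (auto simp: pluecker_def)
  have "b \<notin> vec.span {a}"
    using ij by (auto simp: vec.span_singleton pluecker_proportional)
  moreover have "vec.independent {a}" using \<open>a \<noteq> 0\<close> by simp
  ultimately have "vec.independent {b, a}" by (rule vec.independent_insertI)
  then have "vec.dim {b, a} = card {b, a}" by (rule vec.dim_eq_card_independent)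
  moreover have "b \<noteq> a" using \<open>b \<notin> vec.span {a}\<close> vec.span_base by blast
  ultimately show "vec.dim {a, b} = 2" by (simp add: insert_commute)
qed

lemma proj_space_span_iff:
  fixes a :: "complex ^ 'n::finite"
  shows "vec.span {a} \<in> proj_space \<longleftrightarrow> a \<noteq> 0"
  by (cases "a = 0") (simp_all add: grassmannian_def vec.dim_eq_card_independent)

lemma proj_spaceE:
  fixes L :: "(complex ^ 'n::finite) set"
  assumes "L \<in> proj_space"
  obtains a where "L = vec.span {a}" "a \<noteq> 0"
proof -
  from assms have L: "vec.subspace L" "vec.dim L = 1" by (auto simp: grassmannian_def)
  obtain B where B: "B \<subseteq> L" "vec.independent B" "L \<subseteq> vec.span B" "card B = vec.dim L"
    by (rule vec.basis_exists)
  from B(4) L(2) obtain a where a: "B = {a}" by (auto simp: card_1_singleton_iff)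
  have "vec.span B = L" using B L by (simp add: vec.span_subspace)
  with a B(2) show ?thesis by (intro that[of a]) auto
qed

lemma grassmannian_span_pair_iff:
  fixes a b :: "complex ^ 'n::finite"
  shows "vec.span {a, b} \<in> grassmannian 2 \<longleftrightarrow> (\<exists>i j. pluecker a b i j \<noteq> 0)"
  by (simp add: grassmannian_def dim_pair_eq_2_iff)

lemma grassmannian_2E:
  fixes P :: "(complex ^ 'n::finite) set"
  assumes "P \<in> grassmannian 2"
  obtains a b where "P = vec.span {a, b}"
proof -
  from assms have P: "vec.subspace P" "vec.dim P = 2" by (auto simp: grassmannian_def)
  obtain B where B: "B \<subseteq> P" "vec.independent B" "P \<subseteq> vec.span B" "card B = vec.dim P"
    by (rule vec.basis_exists)
  from B(4) P(2) obtain a b where "B = {a, b}" by (auto simp: card_2_iff)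
  moreover have "vec.span B = P" using B P by (simp add: vec.span_subspace)
  ultimately show ?thesis by (intro that) auto
qed

lemma span_singleton_eq_iff:
  fixes a b :: "complex ^ 'n::finite"
  assumes "a \<noteq> 0" "b \<noteq> 0"
  shows "vec.span {a} = vec.span {b} \<longleftrightarrow> (\<forall>i j. pluecker a b i j = 0)"
proof
  assume "vec.span {a} = vec.span {b}"
  then have "b \<in> vec.span {a}" by (simp add: vec.span_base)
  then show "\<forall>i j. pluecker a b i j = 0"
    by (auto simp: vec.span_singleton pluecker_proportional)
next
  assume "\<forall>i j. pluecker a b i j = 0"
  then obtain k where k: "b = k *s a"
    using proportional_if_pluecker_zero \<open>a \<noteq> 0\<close> by blast
  with \<open>b \<noteq> 0\<close> have "k \<noteq> 0" by auto
  then have "a = inverse k *s b" using k by (simp add: vec.scale_scale)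
  then have "a \<in> vec.span {b}" by (metis vec.span_base vec.span_scale singletonI)
  moreover have "b \<in> vec.span {a}" by (simp add: k vec.span_base vec.span_scale)
  ultimately show "vec.span {a} = vec.span {b}"
    by (simp add: vec.span_eq)
qed

text \<open>
  The scalar is the determinant of the base change matrix. It is the reason why the Pluecker
  coordinates of a plane are unique up to a nonzero factor.
\<close>

lemma pluecker_change_of_basis:
  fixes a b a' b' :: "complex ^ 'n::finite"
  assumes "vec.span {a, b} \<in> grassmannian 2" and "vec.span {a', b'} = vec.span {a, b}"
  obtains c where "c \<noteq> 0" "\<And>i j. pluecker a' b' i j = c * pluecker a b i j"
proof -
  have comb: "\<exists>k m. x = k *s a + m *s b" if "x \<in> vec.span {a, b}" for x
    using that unfolding vec.span_insert[of a] vec.span_singleton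
    by (force simp: algebra_simps)
  have "a' \<in> vec.span {a, b}" "b' \<in> vec.span {a, b}"
    using assms(2) vec.span_base[of a' "{a', b'}"] vec.span_base[of b' "{a', b'}"] by auto
  with comb obtain k m k' m' where kk: "a' = k *s a + m *s b" "b' = k' *s a + m' *s b"
    by metis
  have *: "pluecker a' b' i j = (k * m' - m * k') * pluecker a b i j" for i j
    by (simp add: kk pluecker_def algebra_simps)
  have "\<exists>i j. pluecker a' b' i j \<noteq> 0"
    using assms by (simp flip: grassmannian_span_pair_iff)
  with * show ?thesis by (intro that[of "k * m' - m * k'"]) auto
qed

lemma span_span_Un:
  fixes a b :: "complex ^ 'n::finite"
  shows "vec.span (vec.span {a} \<union> vec.span {b}) = vec.span {a, b}"
proof (rule antisym)
  show "vec.span (vec.span {a} \<union> vec.span {b}) \<subseteq> vec.span {a, b}"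
    by (intro vec.span_minimal Un_least vec.span_mono) auto
  show "vec.span {a, b} \<subseteq> vec.span (vec.span {a} \<union> vec.span {b})"
    by (intro vec.span_mono) (auto intro: vec.span_base)
qed

lemma span_eq_lineE:
  fixes a b :: "complex ^ 'n::finite"
  assumes "vec.span {a} = L" "vec.span {b} = L" "L \<in> proj_space"
  obtains k where "k \<noteq> 0" "b = k *s a"
proof -
  have "b \<noteq> 0" using assms(2,3) proj_space_span_iff by blast
  have "b \<in> vec.span {a}" by (metis assms(1,2) singletonI vec.span_base)
  then obtain k where "b = k *s a" by (auto simp: vec.span_singleton)
  with \<open>b \<noteq> 0\<close> show ?thesis by (intro that[of k]) auto
qed

lemma span_lines_in_grassmannian:
  fixes L M :: "(complex ^ 'n::finite) set"
  assumes "L \<in> proj_space" "M \<in> proj_space" "L \<noteq> M"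
  shows "vec.span (L \<union> M) \<in> grassmannian 2"
proof -
  obtain a b where ab: "L = vec.span {a}" "a \<noteq> 0" "M = vec.span {b}" "b \<noteq> 0"
    using assms(1,2) by (metis proj_spaceE)
  then show ?thesis
    using assms(3) by (simp add: span_span_Un grassmannian_span_pair_iff span_singleton_eq_iff)
qed

lemma plane_through_lines:
  fixes L M :: "(complex ^ 'n::finite) set"
  assumes "L \<in> proj_space" "M \<in> proj_space" "L \<noteq> M" "P \<in> grassmannian 2" "L \<subseteq> P" "M \<subseteq> P"
  shows "P = vec.span (L \<union> M)"
proof -
  have P: "vec.subspace P" "vec.dim P = 2" using assms(4) by (auto simp: grassmannian_def)
  have "vec.span (L \<union> M) \<subseteq> P" using assms(5,6) P(1) by (intro vec.span_minimal) auto
  moreover have "vec.dim P \<le> vec.dim (vec.span (L \<union> M))"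
    using span_lines_in_grassmannian[OF assms(1-3)] P by (auto simp: grassmannian_def)
  ultimately have "vec.span (L \<union> M) = P"
    using P(1) by (intro vec.subspace_dim_equal) auto
  then show ?thesis ..
qed

section \<open>Multihomogeneous forms\<close>

text \<open>
  Rescaling the block \<open>i\<close> by \<open>c i\<close> multiplies a form by a factor that depends only on its
  multidegree; hence the product over blocks, which is the same for both summands of a sum.
\<close>

lemma multiform_rescale:
  assumes "multiform X b d F" and "finite (b ` X)"
    and "\<And>x. x \<in> X \<Longrightarrow> w x = c (b x) * z x"
  shows "F w = (\<Prod>i\<in>b ` X. c i ^ d i) * F z"
  using assms(1)
proof induction
  case (const c)
  then show ?case by simp
next
  case (var x)
  \<comment> \<open>The degree of a variable is concentrated in its own block.\<close>
  have "(\<Prod>i\<in>b ` X. c i ^ (if i = b x then 1 else 0)) = (\<Prod>i\<in>b ` X. if i = b x then c i else 1)"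
    by (rule prod.cong) auto
  also have "\<dots> = c (b x)" using var assms(2) by simp
  finally show ?case using var assms(3) by simp
next
  case (add d F G)
  then show ?case by (simp add: algebra_simps)
next
  case (mult d F d' G)
  then show ?case by (simp add: power_add prod.distrib algebra_simps)
qed

text \<open>
  The degree of the substituted form has to be a function of \<open>d\<close> alone, since both summands of a
  sum need the same one. This is why the degree of \<open>\<Phi> z y\<close> may depend only on the block of \<open>y\<close>.
\<close>

lemma multiform_substitute:
  assumes "multiform Y b' d F" and "finite (b' ` Y)"
    and coord: "\<And>y. y \<in> Y \<Longrightarrow> multiform X b (\<delta> (b' y)) (\<lambda>z. \<Phi> z y)"
  shows "multiform X b (\<lambda>i. \<Sum>j\<in>b' ` Y. d j * \<delta> j i) (\<lambda>z. F (\<Phi> z))"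
  using assms(1)
proof induction
  case (const c)
  then show ?case by (simp add: multiform.const)
next
  case (var y)
  have "(\<Sum>j\<in>b' ` Y. (if j = b' y then 1 else 0) * \<delta> j i) = \<delta> (b' y) i" for i
    using var assms(2) by (simp add: if_distrib[of "\<lambda>x. x * _"] cong: if_cong)
  then show ?case using coord[OF var] by simp
next
  case (add d F G)
  show ?case using add.IH by (rule multiform.add)
next
  case (mult d F d' G)
  from multiform.mult[OF mult.IH] show ?case
    by (simp add: algebra_simps sum.distrib)
qed

lemma multiform_diff:
  assumes "multiform X b d F" "multiform X b d G"
  shows "multiform X b d (\<lambda>z. F z - G z)"
proof -
  have "multiform X b d (\<lambda>z. - G z)"
    using multiform.mult[OF multiform.const assms(2), of "-1"] by simp
  from multiform.add[OF assms(1) this] show ?thesis by simp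
qed

lemma multiform_minor:
  assumes "\<And>i. (u, i) \<in> X" "\<And>i. (v, i) \<in> X"
  shows "multiform X fst (\<lambda>k. (if k = u then 1 else 0) + (if k = v then 1 else 0))
    (\<lambda>z. z (u, i) * z (v, j) - z (u, j) * z (v, i))"
  using multiform.mult[OF multiform.var multiform.var, OF assms, of fst] 
  by (intro multiform_diff) auto

lemma multiform_on_line:
  assumes "multiform X b d F"
  obtains p where "\<And>t. F (\<lambda>x. z x + t * y x) = poly p t"
proof -
  have "\<exists>p. \<forall>t. F (\<lambda>x. z x + t * y x) = poly p t"
    using assms
  proof induction
    case (const c)
    show ?case by (rule exI[of _ "[:c:]"]) simp
  next
    case (var x)
    show ?case by (rule exI[of _ "[:z x, y x:]"]) simp
  next
    case (add d F G)
    then obtain p q where "\<forall>t. F (\<lambda>x. z x + t * y x) = poly p t"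
      "\<forall>t. G (\<lambda>x. z x + t * y x) = poly q t" by (elim exE)
    then show ?case by (intro exI[of _ "p + q"]) simp
  next
    case (mult d F d' G)
    then obtain p q where "\<forall>t. F (\<lambda>x. z x + t * y x) = poly p t"
      "\<forall>t. G (\<lambda>x. z x + t * y x) = poly q t" by (elim exE)
    then show ?case by (intro exI[of _ "p * q"]) simp
  qed
  then show ?thesis using that by (elim exE) blast
qed

section \<open>Zariski topology and morphisms given by forms\<close>

text \<open>
  Existence of homogeneous coordinates and their uniqueness up to one scalar per block, the
  properties that make the vanishing of a form at a point meaningful.
\<close>

definition well_coordinatized :: "('p, 'x, 'i) ambient \<Rightarrow> bool" where
  "well_coordinatized A \<longleftrightarrow> finite (block A ` hvars A) \<and>
     (\<forall>p\<in>points A. hcoords A p \<noteq> {} \<and>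
       (\<forall>z\<in>hcoords A p. \<forall>w\<in>hcoords A p. \<exists>c. \<forall>x\<in>hvars A.
          c (block A x) \<noteq> 0 \<and> w x = c (block A x) * z x))"

lemma well_coordinatized_coords:
  assumes "well_coordinatized A" "p \<in> points A"
  obtains z where "z \<in> hcoords A p"
proof -
  have "hcoords A p \<noteq> {}" using assms by (simp add: well_coordinatized_def)
  then show ?thesis using that by blast
qed

lemma formsI: "multiform (hvars A) (block A) d F \<Longrightarrow> F \<in> forms A"
  unfolding forms_def mem_Collect_eq by (rule exI[where x = d])

lemma form_nonzero_independent:
  assumes A: "well_coordinatized A" "p \<in> points A" "F \<in> forms A"
    and z: "z \<in> hcoords A p" and w: "w \<in> hcoords A p" and nz: "F z \<noteq> 0"
  shows "F w \<noteq> 0"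
proof -
  obtain d where d: "multiform (hvars A) (block A) d F" using A(3) by (auto simp: forms_def)
  have "\<exists>c. \<forall>x\<in>hvars A. c (block A x) \<noteq> 0 \<and> w x = c (block A x) * z x"
    using A(1,2) z w by (simp add: well_coordinatized_def)
  then obtain c where c: "\<forall>x\<in>hvars A. c (block A x) \<noteq> 0 \<and> w x = c (block A x) * z x" ..
  have fin: "finite (block A ` hvars A)" using A(1) by (simp add: well_coordinatized_def)
  have "F w = (\<Prod>i\<in>block A ` hvars A. c i ^ d i) * F z"
    by (rule multiform_rescale[OF d fin]) (simp add: c)
  moreover have "(\<Prod>i\<in>block A ` hvars A. c i ^ d i) \<noteq> 0"
    using c fin by auto
  ultimately show ?thesis using nz by simp
qed

lemma principal_open_iff:
  assumes "well_coordinatized A" "F \<in> forms A" "p \<in> points A" "z \<in> hcoords A p"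
  shows "p \<in> principal_open A F \<longleftrightarrow> F z \<noteq> 0"
proof
  show "p \<in> principal_open A F \<Longrightarrow> F z \<noteq> 0" using assms(4) by (simp add: principal_open_def)
next
  assume "F z \<noteq> 0"
  then have "\<forall>w\<in>hcoords A p. F w \<noteq> 0"
    using form_nonzero_independent[OF assms(1,3,2,4)] by blast
  then show "p \<in> principal_open A F" using assms(3) by (simp add: principal_open_def)
qed

lemma openin_zariski_iff:
  "openin (zariski A X) U \<longleftrightarrow> (\<exists>W. zariski_open A W \<and> U = W \<inter> X)"
  by (simp add: zariski_def openin_subtopology topology_inverse'[OF istopology_zariski_open])

text \<open>
  The principal open sets of the ambient space form a base of the Zariski topology, and this passes
  to subspaces.
\<close>

lemma openin_zariski_pointwise:
  "openin (zariski A X) U \<longleftrightarrow>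
    U \<subseteq> X \<and> (\<forall>p\<in>U. \<exists>F\<in>forms A. p \<in> principal_open A F \<and> principal_open A F \<inter> X \<subseteq> U)"
  (is "_ \<longleftrightarrow> ?R")
proof
  assume "openin (zariski A X) U"
  then show ?R unfolding openin_zariski_iff zariski_open_iff by blast
next
  assume R: ?R
  define S where "S = {F \<in> forms A. principal_open A F \<inter> X \<subseteq> U}"
  have "U = (\<Union>F\<in>S. principal_open A F) \<inter> X" using R unfolding S_def by blast
  moreover have "zariski_open A (\<Union>F\<in>S. principal_open A F)"
    unfolding zariski_open_def by (rule exI[of _ S]) (simp add: S_def)
  ultimately show "openin (zariski A X) U" unfolding openin_zariski_iff by blast
qed

lemma openin_zariskiE:
  assumes "openin (zariski A X) U" "p \<in> U"
  obtains F where "F \<in> forms A" "p \<in> principal_open A F" "principal_open A F \<inter> X \<subseteq> U"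
proof -
  have "\<exists>F\<in>forms A. p \<in> principal_open A F \<and> principal_open A F \<inter> X \<subseteq> U"
    using assms by (simp add: openin_zariski_pointwise)
  then show ?thesis by (elim bexE conjE) (rule that)
qed

lemma topspace_zariski:
  assumes "X \<subseteq> points A"
  shows "topspace (zariski A X) = X"
proof
  show "topspace (zariski A X) \<subseteq> X" by (auto simp: zariski_def)
  have one: "(\<lambda>_. 1) \<in> forms A"
    by (rule formsI) (rule multiform.const)
  have "principal_open A (\<lambda>_. 1) = points A" by (simp add: principal_open_def)
  then have "openin (zariski A X) X"
    using assms unfolding openin_zariski_pointwise
    by (intro conjI ballI bexI[OF _ one]) auto
  then show "X \<subseteq> topspace (zariski A X)" by (rule openin_subset)
qed

text \<open>
  A map that lifts to homogeneous coordinates by forms pulls back principal open sets to principal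
  open sets and quotients of forms to quotients of forms, by substitution. The function \<open>\<delta>\<close> gives
  the multidegree of the coordinates in each block of the target.
\<close>

lemma morphism_by_forms:
  fixes A :: "('p, 'x, 'i) ambient" and B :: "('q, 'y, 'j) ambient"
  assumes A: "well_coordinatized A" and B: "well_coordinatized B"
    and X: "X \<subseteq> points A" and Y: "Y \<subseteq> points B" and maps: "\<phi> ` X \<subseteq> Y"
    and coords: "\<And>p z. p \<in> X \<Longrightarrow> z \<in> hcoords A p \<Longrightarrow> \<Phi> z \<in> hcoords B (\<phi> p)"
    and forms: "\<And>y. y \<in> hvars B \<Longrightarrow>
      multiform (hvars A) (block A) (\<delta> (block B y)) (\<lambda>z. \<Phi> z y)"
  shows "morphism A X B Y \<phi>"
proof -
  have finB: "finite (block B ` hvars B)" using B by (simp add: well_coordinatized_def)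
  have pull: "multiform (hvars A) (block A) (\<lambda>i. \<Sum>j\<in>block B ` hvars B. d j * \<delta> j i)
      (\<lambda>z. F (\<Phi> z))" if "multiform (hvars B) (block B) d F" for d F
    by (rule multiform_substitute[OF that finB]) (rule forms)
  have pull_open: "openin (zariski A X) {p \<in> X. \<phi> p \<in> U}" if U: "openin (zariski B Y) U" for U
    unfolding openin_zariski_pointwise
  proof (intro conjI ballI)
    fix p assume "p \<in> {p \<in> X. \<phi> p \<in> U}"
    then have p: "p \<in> X" "\<phi> p \<in> U" by auto
    from U p(2) obtain F where F: "F \<in> forms B" "\<phi> p \<in> principal_open B F"
      "principal_open B F \<inter> Y \<subseteq> U" by (rule openin_zariskiE)
    obtain d where "multiform (hvars B) (block B) d F" using F(1) by (auto simp: forms_def)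
    from pull[OF this] have F': "(\<lambda>z. F (\<Phi> z)) \<in> forms A" by (rule formsI)
    \<comment> \<open>From left to right this uses that one coordinate vector of \<open>\<phi> q\<close>, here \<open>\<Phi> z\<close>, decides
      whether a form vanishes at \<open>\<phi> q\<close>.\<close>
    have iff: "q \<in> principal_open A (\<lambda>z. F (\<Phi> z)) \<longleftrightarrow> \<phi> q \<in> principal_open B F" if q: "q \<in> X" for q
    proof -
      have qp: "q \<in> points A" "\<phi> q \<in> points B" using q X Y maps by auto
      obtain z where z: "z \<in> hcoords A q" using A qp(1) by (rule well_coordinatized_coords)
      from qp show ?thesis
        using principal_open_iff[OF A F' _ z] principal_open_iff[OF B F(1) _ coords[OF q z]] by simp
    qed
    show "\<exists>F\<in>forms A. p \<in> principal_open A F \<and> principal_open A F \<inter> X \<subseteq> {p \<in> X. \<phi> p \<in> U}"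
      using F' F(2,3) p iff maps by (intro bexI[OF _ F']) auto
  qed auto
  show ?thesis
    unfolding morphism_def
  proof (intro conjI allI impI; (elim conjE)?)
    show "continuous_map (zariski A X) (zariski B Y) \<phi>"
      unfolding continuous_map_def topspace_zariski[OF X] topspace_zariski[OF Y]
      using maps pull_open by blast
  next
    fix U f assume f: "regular_on B Y U f"
    show "regular_on A X {p \<in> X. \<phi> p \<in> U} (f \<circ> \<phi>)"
      unfolding regular_on_def
    proof
      fix p assume "p \<in> {p \<in> X. \<phi> p \<in> U}"
      then have p: "p \<in> X" "\<phi> p \<in> U" by auto
      from f p(2) have "\<exists>W d F G. openin (zariski B Y) W \<and> \<phi> p \<in> W \<and> W \<subseteq> U \<and>
         multiform (hvars B) (block B) d F \<and> multiform (hvars B) (block B) d G \<and>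
         (\<forall>q\<in>W. \<forall>z\<in>hcoords B q. G z \<noteq> 0 \<and> f q = F z / G z)"
        unfolding regular_on_def by (rule bspec)
      then obtain W d F G where W: "openin (zariski B Y) W" "\<phi> p \<in> W" "W \<subseteq> U"
        and FG: "multiform (hvars B) (block B) d F" "multiform (hvars B) (block B) d G"
        and quot: "\<forall>q\<in>W. \<forall>z\<in>hcoords B q. G z \<noteq> 0 \<and> f q = F z / G z"
        by (elim exE conjE) (rule that)
      have "\<forall>q\<in>{q \<in> X. \<phi> q \<in> W}. \<forall>z\<in>hcoords A q.
          G (\<Phi> z) \<noteq> 0 \<and> (f \<circ> \<phi>) q = F (\<Phi> z) / G (\<Phi> z)"
      proof (intro ballI)
        fix q z assume q: "q \<in> {q \<in> X. \<phi> q \<in> W}" and z: "z \<in> hcoords A q"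
        then have "\<phi> q \<in> W" "\<Phi> z \<in> hcoords B (\<phi> q)" using coords by auto
        from bspec[OF bspec[OF quot this(1)] this(2)]
        show "G (\<Phi> z) \<noteq> 0 \<and> (f \<circ> \<phi>) q = F (\<Phi> z) / G (\<Phi> z)"
          unfolding o_apply .
      qed
      moreover have "p \<in> {q \<in> X. \<phi> q \<in> W}" "{q \<in> X. \<phi> q \<in> W} \<subseteq> {p \<in> X. \<phi> p \<in> U}"
        using W(2,3) p by auto
      ultimately show "\<exists>W d F G. openin (zariski A X) W \<and> p \<in> W \<and> W \<subseteq> {p \<in> X. \<phi> p \<in> U} \<and>
         multiform (hvars A) (block A) d F \<and> multiform (hvars A) (block A) d G \<and>
         (\<forall>q\<in>W. \<forall>z\<in>hcoords A q. G z \<noteq> 0 \<and> (f \<circ> \<phi>) q = F z / G z)"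
        using pull_open[OF W(1)] pull[OF FG(1)] pull[OF FG(2)]
        apply -
        apply (rule exI[of _ "{q \<in> X. \<phi> q \<in> W}"])
        apply (rule exI[of _ "\<lambda>i. \<Sum>j\<in>block B ` hvars B. d j * \<delta> j i"])
        apply (rule exI[of _ "\<lambda>z. F (\<Phi> z)"], rule exI[of _ "\<lambda>z. G (\<Phi> z)"])
        apply (intro conjI)
        by assumption+
    qed
  qed
qed


section \<open>Homogeneous coordinates of configurations and pictures\<close>

lemma vertex_ambient_simps:
  "points (vertex_ambient V) = V \<rightarrow>\<^sub>E proj_space"
  "hvars (vertex_ambient V) = V \<times> UNIV"
  "block (vertex_ambient V) = fst"
  "hcoords (vertex_ambient V) l = {z. \<forall>v\<in>V. vec.span {\<chi> i. z (v, i)} = l v}"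
  by (simp_all add: vertex_ambient_def)

lemma picture_ambient_simps:
  "points (picture_ambient V E) = (V \<rightarrow>\<^sub>E proj_space) \<times> (E \<rightarrow>\<^sub>E grassmannian 2)"
  "hvars (picture_ambient V E) = {Point v i | v i. v \<in> V} \<union> {Pluecker e i j | e i j. e \<in> E}"
  "block (picture_ambient V E) = picture_block"
  "hcoords (picture_ambient V E) (l, P) = {z.
     (\<forall>v\<in>V. vec.span {\<chi> i. z (Point v i)} = l v) \<and>
     (\<forall>e\<in>E. \<exists>a b. vec.span {a, b} = P e \<and> (\<forall>i j. z (Pluecker e i j) = pluecker a b i j))}"
  by (simp_all add: picture_ambient_def pluecker_def)

lemma picture_space_subset_points: "picture_space V E \<subseteq> points (picture_ambient V E)"
  by (auto simp: picture_space_def picture_ambient_simps)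

lemma lines_have_generators:
  fixes l :: "'v \<Rightarrow> (complex ^ 'n::finite) set"
  assumes "\<And>v. v \<in> V \<Longrightarrow> l v \<in> proj_space"
  obtains a where "\<forall>v\<in>V. vec.span {a v} = l v"
proof -
  have "\<forall>v\<in>V. \<exists>a. vec.span {a} = l v" using assms by (metis proj_spaceE)
  then show ?thesis using that by metis
qed

lemma lines_rescale:
  fixes l :: "'v \<Rightarrow> (complex ^ 'n::finite) set" and z w :: "'v \<Rightarrow> complex ^ 'n"
  assumes "\<And>v. v \<in> V \<Longrightarrow> l v \<in> proj_space"
    and "\<And>v. v \<in> V \<Longrightarrow> vec.span {z v} = l v" "\<And>v. v \<in> V \<Longrightarrow> vec.span {w v} = l v"
  shows "\<exists>c. \<forall>v\<in>V. c v \<noteq> 0 \<and> w v = c v *s z v"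
proof (rule bchoice, rule ballI)
  fix v assume "v \<in> V"
  with assms obtain k where "k \<noteq> 0" "w v = k *s z v" by (metis span_eq_lineE)
  then show "\<exists>c. c \<noteq> 0 \<and> w v = c *s z v" by blast
qed

lemma well_coordinatized_vertex_ambient:
  assumes "finite V"
  shows "well_coordinatized (vertex_ambient V ::
    ('v \<Rightarrow> (complex ^ 'n::finite) set, 'v \<times> 'n, 'v) ambient)" (is "well_coordinatized ?A")
  unfolding well_coordinatized_def
proof (intro conjI ballI)
  show "finite (block ?A ` hvars ?A)"
    using assms by (simp add: vertex_ambient_simps)
next
  fix l :: "'v \<Rightarrow> (complex ^ 'n) set"
  assume "l \<in> points ?A"
  then have l: "\<And>v. v \<in> V \<Longrightarrow> l v \<in> proj_space" by (auto simp: vertex_ambient_simps)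
  then obtain a where "\<forall>v\<in>V. vec.span {a v} = l v" by (rule lines_have_generators)
  then have "(\<lambda>(v, i). a v $ i) \<in> hcoords ?A l"
    by (simp add: vertex_ambient_simps)
  then show "hcoords ?A l \<noteq> {}" by blast
  fix z w :: "'v \<times> 'n \<Rightarrow> complex"
  assume z: "z \<in> hcoords ?A l" and w: "w \<in> hcoords ?A l"
  have "\<exists>c. \<forall>v\<in>V. c v \<noteq> 0 \<and> (\<chi> i. w (v, i)) = c v *s (\<chi> i. z (v, i))"
    using z w by (intro lines_rescale[OF l]) (auto simp: vertex_ambient_simps)
  then obtain c where c: "\<forall>v\<in>V. c v \<noteq> 0 \<and> (\<chi> i. w (v, i)) = c v *s (\<chi> i. z (v, i))" ..
  then show "\<exists>c. \<forall>x\<in>hvars ?A.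
      c (block ?A x) \<noteq> 0 \<and> w x = c (block ?A x) * z x"
    by (intro exI[of _ c]) (auto simp: vertex_ambient_simps vec_eq_iff)
qed

text \<open>
  Generators of a line are unique up to a nonzero scalar, and so are the Pluecker coordinates of a
  plane; the scaling factors for the two kinds of blocks are combined by \<open>case_sum\<close>.
\<close>

lemma well_coordinatized_picture_ambient:
  assumes "finite V" "finite E"
  shows "well_coordinatized (picture_ambient V E ::
    (('v, 'n) picture, ('v, 'n::finite) picture_var, 'v + 'v set) ambient)" (is "well_coordinatized ?B")
  unfolding well_coordinatized_def
proof (intro conjI ballI)
  have "block ?B ` hvars ?B \<subseteq> Inl ` V \<union> Inr ` E" by (auto simp: picture_ambient_simps)
  then show "finite (block ?B ` hvars ?B)" by (rule finite_subset) (simp add: assms)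
next
  fix p :: "('v, 'n) picture"
  assume p: "p \<in> points ?B"
  obtain l P where lP: "p = (l, P)" by (cases p)
  from p have l: "\<And>v. v \<in> V \<Longrightarrow> l v \<in> proj_space"
    and P: "\<And>e. e \<in> E \<Longrightarrow> P e \<in> grassmannian 2" by (auto simp: picture_ambient_simps lP)
  obtain x where x: "\<forall>v\<in>V. vec.span {x v} = l v" using l by (rule lines_have_generators)
  have "\<forall>e\<in>E. \<exists>a b. vec.span {a, b} = P e" using P by (metis grassmannian_2E)
  then obtain a b where ab: "\<And>e. e \<in> E \<Longrightarrow> vec.span {a e, b e} = P e" by metis
  from ab have "\<forall>e\<in>E. \<exists>a' b'. vec.span {a', b'} = P e \<and>
    (\<forall>i j. pluecker (a e) (b e) i j = pluecker a' b' i j)" by blast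
  then have "case_picture_var (\<lambda>v i. x v $ i) (\<lambda>e i j. pluecker (a e) (b e) i j) \<in> hcoords ?B p"
    using x by (simp add: picture_ambient_simps lP)
  then show "hcoords ?B p \<noteq> {}" by blast
  fix z w
  assume z: "z \<in> hcoords ?B p" and w: "w \<in> hcoords ?B p"
  have "\<exists>c. \<forall>v\<in>V. c v \<noteq> 0 \<and> (\<chi> i. w (Point v i)) = c v *s (\<chi> i. z (Point v i))"
    using z w by (intro lines_rescale[OF l]) (auto simp: picture_ambient_simps lP)
  then obtain c where c: "\<forall>v\<in>V. c v \<noteq> 0 \<and> (\<chi> i. w (Point v i)) = c v *s (\<chi> i. z (Point v i))" ..
  have "\<exists>k. k \<noteq> 0 \<and> (\<forall>i j. w (Pluecker e i j) = k * z (Pluecker e i j))" if e: "e \<in> E" for e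
  proof -
    obtain a b where ab: "vec.span {a, b} = P e" "\<And>i j. z (Pluecker e i j) = pluecker a b i j"
      using z e by (auto simp: picture_ambient_simps lP)
    obtain a' b' where ab': "vec.span {a', b'} = P e"
      "\<And>i j. w (Pluecker e i j) = pluecker a' b' i j"
      using w e by (auto simp: picture_ambient_simps lP)
    obtain k where "k \<noteq> 0" "\<And>i j. pluecker a' b' i j = k * pluecker a b i j"
      using pluecker_change_of_basis[of a b a' b'] P[OF e] ab(1) ab'(1) by auto
    then show ?thesis using ab(2) ab'(2) by auto
  qed
  then obtain k where k: "\<And>e. e \<in> E \<Longrightarrow> k e \<noteq> 0"
    "\<And>e i j. e \<in> E \<Longrightarrow> w (Pluecker e i j) = k e * z (Pluecker e i j)" by metis
  show "\<exists>c. \<forall>x\<in>hvars ?B. c (block ?B x) \<noteq> 0 \<and> w x = c (block ?B x) * z x"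
    using c k by (intro exI[of _ "case_sum c k"]) (auto simp: picture_ambient_simps vec_eq_iff)
qed

section \<open>The embedding and its inverse\<close>

lemma edgeE:
  assumes "finite_simple_graph V E" "e \<in> E"
  obtains u v where "e = {u, v}" "u \<in> V" "v \<in> V" "u \<noteq> v"
proof -
  from assms have "e \<subseteq> V" "card e = 2" by (auto simp: finite_simple_graph_def)
  then show ?thesis by (auto simp: card_2_iff intro: that)
qed

lemma inj_in_conf_space:
  assumes G: "finite_simple_graph V E" and l: "l \<in> V \<rightarrow>\<^sub>E proj_space" "inj_on l V"
  shows "l \<in> conf_space V E"
proof -
  have "l u \<noteq> l v" if "{u, v} \<in> E" for u v
  proof -
    from edgeE[OF G that] have "u \<in> V" "v \<in> V" "u \<noteq> v" by (auto simp: doubleton_eq_iff)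
    then show ?thesis using l(2) by (auto dest: inj_onD)
  qed
  then show ?thesis using l(1) by (simp add: conf_space_def)
qed

lemma conf_embedding_in_picture_space:
  fixes l :: "'v \<Rightarrow> (complex ^ 'n::finite) set"
  assumes G: "finite_simple_graph V E" and l: "l \<in> conf_space V E"
  shows "conf_embedding E l \<in> picture_space V E"
proof -
  have lines: "\<And>v. v \<in> V \<Longrightarrow> l v \<in> proj_space" using l by (auto simp: conf_space_def)
  have "vec.span (\<Union>v\<in>e. l v) \<in> grassmannian 2" if e: "e \<in> E" for e
  proof -
    obtain u v where uv: "e = {u, v}" "u \<in> V" "v \<in> V" using G e by (rule edgeE)
    moreover have "l u \<noteq> l v" using l e uv(1) by (auto simp: conf_space_def)
    ultimately show ?thesis using span_lines_in_grassmannian[OF lines lines] by auto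
  qed
  moreover have "l u \<subseteq> vec.span (\<Union>v\<in>e. l v)" if "u \<in> e" for u e
    using that vec.span_superset[of "\<Union>v\<in>e. l v"] by blast
  ultimately show ?thesis
    using l by (auto simp: conf_embedding_def picture_space_def conf_space_def
        intro: vec.span_base)
qed

text \<open>
  Over the locus of distinct endpoints, the plane of an edge has to be the span of the two lines
  it contains.
\<close>

lemma image_conf_embedding:
  assumes G: "finite_simple_graph V E"
  shows "conf_embedding E ` (conf_space V E :: ('v \<Rightarrow> (complex ^ 'n::finite) set) set) =
    {(l, P) \<in> picture_space V E. \<forall>u v. {u, v} \<in> E \<longrightarrow> l u \<noteq> l v}"
proof (intro equalityI subsetI)
  fix p :: "('v, 'n) picture"
  assume "p \<in> conf_embedding E ` conf_space V E"
  then obtain l where l: "l \<in> conf_space V E" "p = conf_embedding E l" by blast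
  with conf_embedding_in_picture_space[OF G l(1)]
  show "p \<in> {(l, P) \<in> picture_space V E. \<forall>u v. {u, v} \<in> E \<longrightarrow> l u \<noteq> l v}"
    by (auto simp: conf_embedding_def conf_space_def)
next
  fix p :: "('v, 'n) picture"
  assume p: "p \<in> {(l, P) \<in> picture_space V E. \<forall>u v. {u, v} \<in> E \<longrightarrow> l u \<noteq> l v}"
  obtain l P where lP: "p = (l, P)" by (cases p)
  with p have l: "l \<in> conf_space V E" and lP': "(l, P) \<in> picture_space V E"
    by (auto simp: conf_space_def picture_space_def)
  have "P = (\<lambda>e\<in>E. vec.span (\<Union>v\<in>e. l v))"
  proof (rule extensionalityI[of P E])
    show "P \<in> extensional E" using lP' by (auto simp: picture_space_def PiE_def)
    fix e assume e: "e \<in> E"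
    obtain u v where uv: "e = {u, v}" "u \<in> V" "v \<in> V" using G e by (rule edgeE)
    have "P e = vec.span (l u \<union> l v)"
      using l lP' e uv by (intro plane_through_lines) (auto simp: conf_space_def picture_space_def)
    then show "P e = (\<lambda>e\<in>E. vec.span (\<Union>v\<in>e. l v)) e" using e uv(1) by simp
  qed simp
  then have "p = conf_embedding E l" by (simp add: lP conf_embedding_def)
  with l show "p \<in> conf_embedding E ` conf_space V E" by blast
qed

lemma morphism_conf_embedding:
  assumes G: "finite_simple_graph V E"
    and Y: "conf_embedding E ` conf_space V E \<subseteq> Y" "Y \<subseteq> picture_space V E"
  shows "morphism (vertex_ambient V) (conf_space V E :: ('v \<Rightarrow> (complex ^ 'n::finite) set) set)
    (picture_ambient V E) Y (conf_embedding E)"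
proof -
  let ?A = "vertex_ambient V :: ('v \<Rightarrow> (complex ^ 'n) set, 'v \<times> 'n, 'v) ambient"
  let ?B = "picture_ambient V E :: (('v, 'n) picture, ('v, 'n) picture_var, 'v + 'v set) ambient"
  have fin: "finite V" "finite E"
    using G by (auto simp: finite_simple_graph_def intro: finite_subset[of E "Pow V"])
  \<comment> \<open>Pluecker coordinates depend on the order of the two generators, so each edge is oriented.\<close>
  have "\<forall>e\<in>E. \<exists>u v. e = {u, v} \<and> u \<in> V \<and> v \<in> V \<and> u \<noteq> v" using G by (metis edgeE)
  then obtain s t where st: "\<And>e. e \<in> E \<Longrightarrow> e = {s e, t e} \<and> s e \<in> V \<and> t e \<in> V \<and> s e \<noteq> t e"
    by metis
  define \<Phi> :: "('v \<times> 'n \<Rightarrow> complex) \<Rightarrow> ('v, 'n) picture_var \<Rightarrow> complex" where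
    "\<Phi> z = case_picture_var (\<lambda>v i. z (v, i))
      (\<lambda>e i j. z (s e, i) * z (t e, j) - z (s e, j) * z (t e, i))" for z
  define \<delta> :: "'v + 'v set \<Rightarrow> 'v \<Rightarrow> nat" where
    "\<delta> = case_sum (\<lambda>v k. if k = v then 1 else 0)
      (\<lambda>e k. (if k = s e then 1 else 0) + (if k = t e then 1 else 0))"
  show ?thesis
  proof (rule morphism_by_forms[where \<Phi> = \<Phi> and \<delta> = \<delta>])
    show "well_coordinatized ?A" using fin(1) by (rule well_coordinatized_vertex_ambient)
    show "well_coordinatized ?B" using fin by (rule well_coordinatized_picture_ambient)
    show "conf_space V E \<subseteq> points ?A" by (auto simp: conf_space_def vertex_ambient_simps)
    show "Y \<subseteq> points ?B" using Y(2) picture_space_subset_points by (rule order_trans)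
    show "conf_embedding E ` conf_space V E \<subseteq> Y" by fact
  next
    fix l :: "'v \<Rightarrow> (complex ^ 'n) set" and z
    assume "l \<in> conf_space V E" and z: "z \<in> hcoords ?A l"
    have *: "vec.span {\<chi> i. z (v, i)} = l v" if "v \<in> V" for v
      using z that by (simp add: vertex_ambient_simps)
    have "\<exists>a b. vec.span {a, b} = vec.span (\<Union>v\<in>e. l v) \<and>
      (\<forall>i j. \<Phi> z (Pluecker e i j) = pluecker a b i j)" if e: "e \<in> E" for e
    proof (intro exI conjI allI)
      from st[OF e] have e_eq: "e = {s e, t e}" by simp
      have "(\<Union>v\<in>e. l v) = l (s e) \<union> l (t e)" by (subst e_eq) simp
      then show "vec.span {\<chi> i. z (s e, i), \<chi> i. z (t e, i)} = vec.span (\<Union>v\<in>e. l v)"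
        using st[OF e] by (simp flip: * span_span_Un)
    qed (simp add: \<Phi>_def pluecker_def)
    then show "\<Phi> z \<in> hcoords ?B (conf_embedding E l)"
      by (auto simp: picture_ambient_simps conf_embedding_def \<Phi>_def *)
  next
    fix y assume "y \<in> hvars ?B"
    then consider v i where "y = Point v i" "v \<in> V" | e i j where "y = Pluecker e i j" "e \<in> E"
      by (auto simp: picture_ambient_simps)
    then show "multiform (hvars ?A) (block ?A) (\<delta> (block ?B y)) (\<lambda>z. \<Phi> z y)"
    proof cases
      case 1
      then show ?thesis
        using multiform.var[of "(v, i)" "V \<times> UNIV" fst]
        by (simp add: \<delta>_def \<Phi>_def picture_ambient_simps vertex_ambient_simps)
    next
      case 2
      then show ?thesis
        using st[OF 2(2)] by (auto intro!: multiform_minor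
          simp: \<delta>_def \<Phi>_def picture_ambient_simps vertex_ambient_simps)
    qed
  qed
qed

lemma morphism_fst:
  assumes G: "finite_simple_graph V E"
    and Y: "Y \<subseteq> picture_space V E" and X: "fst ` Y \<subseteq> X" "X \<subseteq> points (vertex_ambient V)"
  shows "morphism (picture_ambient V E) Y
    (vertex_ambient V :: ('v \<Rightarrow> (complex ^ 'n::finite) set, 'v \<times> 'n, 'v) ambient) X fst"
proof -
  let ?A = "vertex_ambient V :: ('v \<Rightarrow> (complex ^ 'n) set, 'v \<times> 'n, 'v) ambient"
  let ?B = "picture_ambient V E :: (('v, 'n) picture, ('v, 'n) picture_var, 'v + 'v set) ambient"
  have fin: "finite V" "finite E"
    using G by (auto simp: finite_simple_graph_def intro: finite_subset[of E "Pow V"])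
  show ?thesis
  proof (rule morphism_by_forms[where \<Phi> = "\<lambda>z (v, i). z (Point v i)"
        and \<delta> = "\<lambda>v k. if k = Inl v then 1 else 0"])
    show "well_coordinatized ?A" using fin(1) by (rule well_coordinatized_vertex_ambient)
    show "well_coordinatized ?B" using fin by (rule well_coordinatized_picture_ambient)
    show "Y \<subseteq> points ?B" using Y picture_space_subset_points by (rule order_trans)
    show "X \<subseteq> points ?A" "fst ` Y \<subseteq> X" by fact+
  next
    fix p :: "('v, 'n) picture" and z assume "z \<in> hcoords ?B p"
    then show "(\<lambda>(v, i). z (Point v i)) \<in> hcoords ?A (fst p)"
      by (cases p) (simp add: picture_ambient_simps vertex_ambient_simps)
  next
    fix y assume "y \<in> hvars ?A"
    then obtain v i where "y = (v, i)" "v \<in> V" by (auto simp: vertex_ambient_simps)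
    then show "multiform (hvars ?B) (block ?B) (\<lambda>k. if k = Inl (block ?A y) then 1 else 0)
        (\<lambda>z. case y of (v, i) \<Rightarrow> z (Point v i))"
      using multiform.var[of "Point v i" "hvars ?B" picture_block]
      by (simp add: picture_ambient_simps vertex_ambient_simps)
  qed
qed

section \<open>Openness and density\<close>

text \<open>
  Near a tuple with \<open>l u \<noteq> l v\<close>, a minor of the generators of the two lines that is nonzero at \<open>l\<close>
  stays nonzero, and this keeps the two lines distinct.
\<close>

lemma openin_distinct_points:
  fixes u v :: 'v
  assumes "finite V" "u \<in> V" "v \<in> V"
  shows "openin (zariski (vertex_ambient V) (V \<rightarrow>\<^sub>E proj_space))
    {l \<in> V \<rightarrow>\<^sub>E proj_space :: ('v \<Rightarrow> (complex ^ 'n::finite) set) set. l u \<noteq> l v}"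
  unfolding openin_zariski_pointwise
proof (intro conjI ballI)
  let ?A = "vertex_ambient V :: ('v \<Rightarrow> (complex ^ 'n) set, 'v \<times> 'n, 'v) ambient"
  have A: "well_coordinatized ?A" using assms(1) by (rule well_coordinatized_vertex_ambient)
  have distinct_iff: "l u \<noteq> l v \<longleftrightarrow> (\<exists>i j. z (u, i) * z (v, j) - z (u, j) * z (v, i) \<noteq> 0)"
    if "l \<in> V \<rightarrow>\<^sub>E proj_space" "z \<in> hcoords ?A l" for l z
  proof -
    have *: "vec.span {\<chi> i. z (x, i)} = l x" "(\<chi> i. z (x, i)) \<noteq> 0" if x: "x \<in> V" for x
    proof -
      show "vec.span {\<chi> i. z (x, i)} = l x"
        using \<open>z \<in> hcoords ?A l\<close> x by (simp add: vertex_ambient_simps)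
      moreover have "l x \<in> proj_space" using \<open>l \<in> V \<rightarrow>\<^sub>E proj_space\<close> x by auto
      ultimately show "(\<chi> i. z (x, i)) \<noteq> 0" using proj_space_span_iff by metis
    qed
    show ?thesis
      using span_singleton_eq_iff[OF *(2)[OF assms(2)] *(2)[OF assms(3)]] assms(2,3)
      by (simp add: *(1) pluecker_def)
  qed
  fix l :: "'v \<Rightarrow> (complex ^ 'n) set"
  assume "l \<in> {l \<in> V \<rightarrow>\<^sub>E proj_space. l u \<noteq> l v}"
  then have l: "l \<in> points ?A" "l u \<noteq> l v" by (auto simp: vertex_ambient_simps)
  obtain z where z: "z \<in> hcoords ?A l" using A l(1) by (rule well_coordinatized_coords)
  from l z obtain i j where ij: "z (u, i) * z (v, j) - z (u, j) * z (v, i) \<noteq> 0"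
    using distinct_iff[of l z] by (auto simp: vertex_ambient_simps)
  define F :: "('v \<times> 'n \<Rightarrow> complex) \<Rightarrow> complex" where
    "F z = z (u, i) * z (v, j) - z (u, j) * z (v, i)" for z
  have "multiform (hvars ?A) (block ?A)
      (\<lambda>k. (if k = u then 1 else 0) + (if k = v then 1 else 0)) F"
    unfolding F_def vertex_ambient_simps using assms by (intro multiform_minor) auto
  then have F: "F \<in> forms ?A" by (rule formsI)
  have "l \<in> principal_open ?A F" using principal_open_iff[OF A F l(1) z] ij by (simp add: F_def)
  moreover have "m u \<noteq> m v" if m: "m \<in> principal_open ?A F" for m
  proof -
    have m': "m \<in> points ?A" using m by (simp add: principal_open_def)
    obtain w where w: "w \<in> hcoords ?A m" using A m' by (rule well_coordinatized_coords)
    have "F w \<noteq> 0" using m w by (simp add: principal_open_def)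
    then show ?thesis using distinct_iff[of m w] m' w by (auto simp: F_def vertex_ambient_simps)
  qed
  ultimately show "\<exists>F\<in>forms ?A. l \<in> principal_open ?A F \<and>
      principal_open ?A F \<inter> (V \<rightarrow>\<^sub>E proj_space) \<subseteq> {l \<in> V \<rightarrow>\<^sub>E proj_space. l u \<noteq> l v}"
    by (intro bexI[OF _ F]) auto
qed auto

lemma openin_conf_space:
  assumes G: "finite_simple_graph V E"
  shows "openin (zariski (vertex_ambient V) (V \<rightarrow>\<^sub>E proj_space))
    (conf_space V E :: ('v \<Rightarrow> (complex ^ 'n::finite) set) set)"
proof -
  let ?T = "zariski (vertex_ambient V) (V \<rightarrow>\<^sub>E proj_space :: ('v \<Rightarrow> (complex ^ 'n) set) set)"
  let ?I = "{(u, v). {u, v} \<in> E}"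
  have "?I \<subseteq> V \<times> V" using G by (auto simp: finite_simple_graph_def)
  moreover have "finite V" using G by (simp add: finite_simple_graph_def)
  ultimately have "finite ?I" by (simp add: finite_subset[of _ "V \<times> V"])
  moreover have "openin ?T {l \<in> V \<rightarrow>\<^sub>E proj_space. l u \<noteq> l v}" if "{u, v} \<in> E" for u v
    using \<open>?I \<subseteq> V \<times> V\<close> \<open>finite V\<close> that by (intro openin_distinct_points) auto
  ultimately have "openin ?T
      ((\<Inter>(u, v)\<in>?I. {l \<in> V \<rightarrow>\<^sub>E proj_space. l u \<noteq> l v}) \<inter> topspace ?T)"
    by (intro openin_INT) auto
  moreover have "topspace ?T = V \<rightarrow>\<^sub>E proj_space"
    by (rule topspace_zariski) (simp add: vertex_ambient_simps)
  moreover have "(\<Inter>(u, v)\<in>?I. {l \<in> V \<rightarrow>\<^sub>E proj_space. l u \<noteq> l v}) \<inter> (V \<rightarrow>\<^sub>E proj_space)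
      = (conf_space V E :: ('v \<Rightarrow> (complex ^ 'n) set) set)"
    by (auto simp: conf_space_def)
  ultimately show ?thesis by simp
qed

text \<open>
  The density of the tuples of pairwise distinct points. Let \<open>z\<close> be coordinates of \<open>l\<close>, and move
  along \<open>z + t y\<close>, where the vectors \<open>y\<^sub>v = e\<^sub>i + c\<^sub>v e\<^sub>j\<close> are pairwise independent because the numbers
  \<open>c\<^sub>v\<close> are distinct; two indices \<open>i \<noteq> j\<close> are available by the assumption on the dimension. The
  polynomial \<open>p\<close> that \<open>F\<close> induces on this line is nonzero at \<open>t = 0\<close>, and the minor \<open>q u v\<close> of the
  vectors of \<open>u\<close> and \<open>v\<close> is a nonzero polynomial since the coefficient of \<open>t\<^sup>2\<close> is \<open>c\<^sub>v - c\<^sub>u\<close>.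
\<close>

lemma injective_meets_principal_open:
  assumes V: "finite V" and n: "CARD('n::finite) \<ge> 2"
    and F: "F \<in> forms (vertex_ambient V)" and l: "l \<in> principal_open (vertex_ambient V) F"
  obtains m :: "'v \<Rightarrow> (complex ^ 'n) set"
  where "m \<in> principal_open (vertex_ambient V) F" "inj_on m V"
proof -
  let ?A = "vertex_ambient V :: ('v \<Rightarrow> (complex ^ 'n) set, 'v \<times> 'n, 'v) ambient"
  have A: "well_coordinatized ?A" using V by (rule well_coordinatized_vertex_ambient)
  obtain S :: "'n set" where "card S = 2" using n by (rule obtain_subset_with_card_n)
  then obtain i j :: 'n where ij: "i \<noteq> j" by (auto simp: card_2_iff)
  obtain f :: "'v \<Rightarrow> nat" where "inj_on f V"
    using finite_imp_inj_to_nat_seg[OF V] by blast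
  define c :: "'v \<Rightarrow> complex" where "c v = of_nat (f v)" for v
  have c: "inj_on c V" using \<open>inj_on f V\<close> by (simp add: inj_on_def c_def)
  have lp: "l \<in> points ?A" using l by (simp add: principal_open_def)
  obtain z where z: "z \<in> hcoords ?A l" using A lp by (rule well_coordinatized_coords)
  obtain d where d: "multiform (hvars ?A) (block ?A) d F" using F by (auto simp: forms_def)
  define y where "y = (\<lambda>(v, k). if k = i then 1 else if k = j then c v else 0)"
  define w where "w t x = z x + t * y x" for t x
  obtain p where p: "\<And>t. F (w t) = poly p t"
    unfolding w_def using multiform_on_line[OF d] by metis
  have "F z \<noteq> 0" using l z by (simp add: principal_open_def)
  moreover have "w 0 = z" by (simp add: w_def fun_eq_iff)
  ultimately have "p \<noteq> 0" using p[of 0] by auto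
  define q where "q u v = [:z (u, i), 1:] * [:z (v, j), c v:] - [:z (u, j), c u:] * [:z (v, i), 1:]"
    for u v
  have q: "poly (q u v) t = w t (u, i) * w t (v, j) - w t (u, j) * w t (v, i)" for u v t
    using ij by (simp add: q_def w_def y_def algebra_simps)
  have q_nz: "q u v \<noteq> 0" if "u \<in> V" "v \<in> V" "u \<noteq> v" for u v
  proof -
    have "coeff (q u v) 2 = c v - c u" by (simp add: q_def numeral_2_eq_2)
    with that c show ?thesis by (metis coeff_0 inj_onD right_minus_eq)
  qed
  \<comment> \<open>The values \<open>- z (v, i)\<close> are excluded to keep every vector nonzero; the minors alone do not
    ensure this when \<open>V\<close> has a single element.\<close>
  let ?bad = "{t. poly p t = 0} \<union> (\<Union>v\<in>V. {- z (v, i)}) \<union>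
    (\<Union>(u, v)\<in>{(u, v) \<in> V \<times> V. u \<noteq> v}. {t. poly (q u v) t = 0})"
  have "finite {(u, v) \<in> V \<times> V. u \<noteq> v}"
    by (rule finite_subset[of _ "V \<times> V"]) (use V in auto)
  then have "finite ?bad"
    using V \<open>p \<noteq> 0\<close> q_nz by (auto intro!: poly_roots_finite)
  from ex_new_if_finite[OF infinite_UNIV_char_0 this] obtain t where t: "t \<notin> ?bad" ..
  define a where "a v = (\<chi> k. w t (v, k))" for v
  have a_nz: "a v \<noteq> 0" if "v \<in> V" for v
  proof
    assume "a v = 0"
    then have "w t (v, i) = 0" by (simp add: a_def vec_eq_iff)
    then have "t = - z (v, i)" by (simp add: w_def y_def eq_neg_iff_add_eq_0 add.commute)
    with t that show False by blast
  qed
  define m where "m = (\<lambda>v\<in>V. vec.span {a v})"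
  have m: "m \<in> points ?A" 
    using a_nz by (auto simp: vertex_ambient_simps m_def proj_space_span_iff simp del: One_nat_def)
  have "w t \<in> hcoords ?A m" by (simp add: vertex_ambient_simps m_def a_def)
  moreover have "F (w t) \<noteq> 0" using t p by simp
  ultimately have "m \<in> principal_open ?A F" using principal_open_iff[OF A F m] by blast
  moreover have "inj_on m V"
  proof (rule inj_onI, rule ccontr)
    fix u v assume uv: "u \<in> V" "v \<in> V" "m u = m v" "u \<noteq> v"
    then have "pluecker (a u) (a v) i j = 0"
      using span_singleton_eq_iff[OF a_nz a_nz] by (simp add: m_def)
    then have "poly (q u v) t = 0" by (simp add: q pluecker_def a_def)
    with t uv show False by blast
  qed
  ultimately show ?thesis by (rule that)
qed

theorem proposition10p1:
  fixes V :: "'v set" and E :: "'v set set"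
  assumes "finite_simple_graph V E"
    and "CARD('n::finite) \<ge> 2"
  shows "open_immersion
           (vertex_ambient V) (conf_space V E :: ('v \<Rightarrow> (complex ^ 'n) set) set)
           (picture_ambient V E) (picture_space V E) (conf_embedding E)
    \<and> conf_embedding E ` (conf_space V E :: ('v \<Rightarrow> (complex ^ 'n) set) set) =
        {(l, P) \<in> picture_space V E. \<forall>u v. {u, v} \<in> E \<longrightarrow> l u \<noteq> l v}
    \<and> conf_embedding E ` (conf_space V E :: ('v \<Rightarrow> (complex ^ 'n) set) set)
        \<subseteq> picture_variety V E
    \<and> zariski (picture_ambient V E) (picture_variety V E) closure_of
        (conf_embedding E ` (conf_space V E :: ('v \<Rightarrow> (complex ^ 'n) set) set))
        = picture_variety V E
    \<and> zariski (picture_ambient V E) (picture_space V E) closure_of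
        (conf_embedding E ` (conf_space V E :: ('v \<Rightarrow> (complex ^ 'n) set) set))
        = picture_variety V E"
proof -
  note G = assms(1)
  let ?A = "vertex_ambient V :: ('v \<Rightarrow> (complex ^ 'n) set, 'v \<times> 'n, 'v) ambient"
  let ?B = "picture_ambient V E :: (('v, 'n) picture, ('v, 'n) picture_var, 'v + 'v set) ambient"
  let ?X = "conf_space V E :: ('v \<Rightarrow> (complex ^ 'n) set) set"
  let ?Y = "picture_space V E :: ('v, 'n) picture set"
  let ?Z = "picture_variety V E :: ('v, 'n) picture set"
  let ?j = "conf_embedding E :: ('v \<Rightarrow> (complex ^ 'n) set) \<Rightarrow> ('v, 'n) picture"
  let ?D = "{(l, P) \<in> ?Y. inj_on l V}"
  have V: "finite V" using G by (simp add: finite_simple_graph_def)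
  have X: "?X \<subseteq> points ?A" by (auto simp: conf_space_def vertex_ambient_simps)
  have Y: "?Y \<subseteq> points ?B" by (rule picture_space_subset_points)
  have jX: "?j ` ?X \<subseteq> ?Y" using conf_embedding_in_picture_space[OF G] by blast
  have topY: "topspace (zariski ?B ?Y) = ?Y" using Y by (rule topspace_zariski)
  note image = image_conf_embedding[OF G, where ?'n = 'n]
  have mor: "morphism ?A ?X ?B ?Y ?j" using G jX by (rule morphism_conf_embedding) simp

  have "openin (zariski ?B ?Y) (?j ` ?X)"
  proof -
    have "morphism ?B ?Y ?A (V \<rightarrow>\<^sub>E proj_space) fst"
      using G by (rule morphism_fst) (auto simp: picture_space_def vertex_ambient_simps)
    then have "continuous_map (zariski ?B ?Y) (zariski ?A (V \<rightarrow>\<^sub>E proj_space)) fst"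
      by (simp add: morphism_def)
    from openin_continuous_map_preimage[OF this openin_conf_space[OF G]]
    have "openin (zariski ?B ?Y) {p \<in> ?Y. fst p \<in> ?X}" unfolding topY .
    moreover have "{p \<in> ?Y. fst p \<in> ?X} = ?j ` ?X"
      unfolding image by (auto simp: picture_space_def conf_space_def)
    ultimately show ?thesis by simp
  qed
  moreover have "isomorphism ?A ?X ?B (?j ` ?X) ?j"
    unfolding isomorphism_def
  proof (intro conjI exI[of _ fst])
    show "morphism ?A ?X ?B (?j ` ?X) ?j" using G _ jX by (rule morphism_conf_embedding) simp
    show "morphism ?B (?j ` ?X) ?A ?X fst"
      using G jX _ X by (rule morphism_fst) (auto simp: conf_embedding_def)
  qed (auto simp: conf_embedding_def)
  ultimately have open_imm: "open_immersion ?A ?X ?B ?Y ?j"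
    using mor by (simp add: open_immersion_def)

  have D_sub: "?D \<subseteq> ?j ` ?X"
  proof
    fix p assume p: "p \<in> ?D"
    obtain l P where lP: "p = (l, P)" by (cases p)
    with p have "(l, P) \<in> ?Y" "inj_on l V" by auto
    then have "l \<in> ?X" by (intro inj_in_conf_space[OF G]) (auto simp: picture_space_def)
    with \<open>(l, P) \<in> ?Y\<close> show "p \<in> ?j ` ?X" unfolding image by (auto simp: lP conf_space_def)
  qed
  \<comment> \<open>A neighbourhood of \<open>j l\<close> is pulled back to the configuration space, where it contains a tuple
    of pairwise distinct points.\<close>
  have dense: "?j ` ?X \<subseteq> zariski ?B ?Y closure_of ?D"
  proof
    fix p assume "p \<in> ?j ` ?X"
    then obtain l where l: "l \<in> ?X" "p = ?j l" by blast
    have "\<exists>r. r \<in> ?D \<and> r \<in> T" if T: "p \<in> T" "openin (zariski ?B ?Y) T" for T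
    proof -
      have "continuous_map (zariski ?A ?X) (zariski ?B ?Y) ?j" using mor by (simp add: morphism_def)
      from openin_continuous_map_preimage[OF this T(2)]
      have "openin (zariski ?A ?X) {l \<in> ?X. ?j l \<in> T}" unfolding topspace_zariski[OF X] .
      moreover have "l \<in> {l \<in> ?X. ?j l \<in> T}" using l T(1) by simp
      ultimately obtain F where F: "F \<in> forms ?A" "l \<in> principal_open ?A F"
        "principal_open ?A F \<inter> ?X \<subseteq> {l \<in> ?X. ?j l \<in> T}" by (rule openin_zariskiE)
      obtain m where m: "m \<in> principal_open ?A F" "inj_on m V"
        using V assms(2) F(1,2) by (rule injective_meets_principal_open)
      have "m \<in> ?X"
        using m by (intro inj_in_conf_space[OF G]) (auto simp: principal_open_def vertex_ambient_simps)
      then have "?j m \<in> T" "?j m \<in> ?Y" using F(3) m(1) jX by auto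
      moreover from this(2) have "?j m \<in> ?D" using m(2) by (simp add: conf_embedding_def)
      ultimately show ?thesis by (intro exI[of _ "?j m"] conjI)
    qed
    moreover have "p \<in> ?Y" using l jX by blast
    ultimately show "p \<in> zariski ?B ?Y closure_of ?D"
      unfolding in_closure_of topY by blast
  qed
  have closure_Y: "zariski ?B ?Y closure_of (?j ` ?X) = ?Z"
    unfolding picture_variety_def
    using closure_of_minimal[OF dense closedin_closure_of] closure_of_mono[OF D_sub]
    by (rule subset_antisym)
  have sub_Z: "?j ` ?X \<subseteq> ?Z" using dense by (simp add: picture_variety_def)
  have "?Z \<subseteq> ?Y" unfolding picture_variety_def
    using closure_of_subset_topspace[of "zariski ?B ?Y" ?D] by (simp add: topY)
  then have "zariski ?B ?Z = subtopology (zariski ?B ?Y) ?Z"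
    by (simp add: zariski_def subtopology_subtopology Int_absorb1)
  then have "zariski ?B ?Z closure_of (?j ` ?X) = ?Z"
    using sub_Z closure_Y by (simp add: closure_of_subtopology Int_absorb1)
  with open_imm image sub_Z closure_Y show ?thesis by (intro conjI)
qed

end
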